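(* Let the schema consist of a single binary relation symbol $R$, and let $\mathbf{T}$ be the Boolean CQ $\mathbf{T}()\text{ :- }R(y_1,y_2)\wedge R(y_2,y_3)\wedge R(y_3,y_4)\wedge R(y_4,y_5)$. There is no pair $(E^+,E^-)$ of finite sets of acyclic structures (with no distinguished elements) that uniquely characterizes $\mathbf{T}$ with respect to the class of Boolean acyclic connected CQs.
   Context: A Boolean CQ is a conjunctive query with no free variables, i.e. an existentially quantified conjunction of atoms; its canonical structure has its variables as elements and its atoms as facts (no distinguished elements). A structure (no distinguished elements) $A$ is a positive example for a Boolean CQ $q$ if $q$ holds in $A$ (equivalently, the canonical structure of $q$ maps homomorphically to $A$), and a negative example otherwise. Two Boolean CQs are logically equivalent if they hold in the same structures. $(E^+,E^-)$ uniquely characterizes $q$ w.r.t. a class $\mathcal{C}$ of CQs if all of $E^+$ are positive and all of $E^-$ negative for $q$, and every $q'\in\mathcal{C}$ with this property is logically equivalent to $q$. The incidence graph of a structure is the bipartite multigraph on its elements and facts with one edge per occurrence of an element in a fact; a structure is acyclic if its incidence graph has no cycle (including length-2 cycles from parallel edges) and connected if its incidence graph is connected; a CQ is acyclic/connected if its canonical structure is.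
   Formalization: The example structures are required to be finite, which the statement leaves implicit; with infinite structures the claim fails (take T as the positive example and the disjoint union of all finite oriented trees that map to T but receive no homomorphism from T as the negative one). *)

theory Defs imports Main
begin

section \<open>Structures and Boolean conjunctive queries over one binary relation symbol\<close>

record 'a rstruct =
  dom_of :: "'a set"
  facts :: "('a \<times> 'a) set"

definition finite_structure :: "'a rstruct \<Rightarrow> bool" where
  "finite_structure A \<longleftrightarrow> finite (dom_of A) \<and> facts A \<subseteq> dom_of A \<times> dom_of A"

definition is_hom :: "('a \<Rightarrow> 'b) \<Rightarrow> 'a rstruct \<Rightarrow> 'b rstruct \<Rightarrow> bool" where
  "is_hom h A B \<longleftrightarrow>
     (\<forall>x\<in>dom_of A. h x \<in> dom_of B) \<and> (\<forall>(x, y)\<in>facts A. (h x, h y) \<in> facts B)"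

text \<open>A Boolean CQ is the list of its conjuncts; all variables are existentially
  quantified, and the variables of a query are those occurring in its atoms.\<close>

datatype atom = R nat nat

type_synonym bcq = "atom list"

fun atom_vars :: "atom \<Rightarrow> nat set" where
  "atom_vars (R x y) = {x, y}"

definition vars :: "bcq \<Rightarrow> nat set" where
  "vars q = (\<Union>a\<in>set q. atom_vars a)"

fun sat_atom :: "'a rstruct \<Rightarrow> (nat \<Rightarrow> 'a) \<Rightarrow> atom \<Rightarrow> bool" where
  "sat_atom A s (R x y) \<longleftrightarrow> (s x, s y) \<in> facts A"

definition holds_in :: "bcq \<Rightarrow> 'a rstruct \<Rightarrow> bool" where
  "holds_in q A \<longleftrightarrow> (\<exists>s. (\<forall>x\<in>vars q. s x \<in> dom_of A) \<and> (\<forall>a\<in>set q. sat_atom A s a))"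

definition canonical :: "bcq \<Rightarrow> nat rstruct" where
  "canonical q = \<lparr>dom_of = vars q, facts = {(x, y). R x y \<in> set q}\<rparr>"

lemma holds_in_iff_hom: "holds_in q A \<longleftrightarrow> (\<exists>h. is_hom h (canonical q) A)"
proof -
  have "(\<forall>a\<in>set q. sat_atom A s a) \<longleftrightarrow> (\<forall>x y. R x y \<in> set q \<longrightarrow> (s x, s y) \<in> facts A)" for s
    by (metis atom.exhaust sat_atom.simps)
  then show ?thesis
    by (simp add: holds_in_def is_hom_def canonical_def)
qed

text \<open>Every finite structure is isomorphic to one with elements in \<^typ>\<open>nat\<close>, so
  quantifying over these amounts to quantifying over all finite structures.\<close>

definition logically_equivalent :: "bcq \<Rightarrow> bcq \<Rightarrow> bool" where
  "logically_equivalent q q' \<longleftrightarrow>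
     (\<forall>A :: nat rstruct. finite_structure A \<longrightarrow> (holds_in q A \<longleftrightarrow> holds_in q' A))"


section \<open>Multigraphs and incidence graphs\<close>

text \<open>\<open>ends e\<close> is the set of endpoints of the edge \<open>e\<close>; distinct edges may have the
  same endpoints.\<close>

record ('v, 'e) multigraph =
  nodes :: "'v set"
  edges :: "'e set"
  ends :: "'e \<Rightarrow> 'v set"

text \<open>The edge \<open>es ! i\<close> joins \<open>vs ! i\<close> to its cyclic successor. Two parallel edges form a
  cycle of length 2.\<close>

definition is_cycle :: "('v, 'e) multigraph \<Rightarrow> 'v list \<Rightarrow> 'e list \<Rightarrow> bool" where
  "is_cycle G vs es \<longleftrightarrow>
     es \<noteq> [] \<and> length vs = length es \<and> distinct vs \<and> distinct es \<and>
     set vs \<subseteq> nodes G \<and> set es \<subseteq> edges G \<and>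
     (\<forall>i<length es. ends G (es ! i) = {vs ! i, vs ! (Suc i mod length es)})"

definition acyclic_multigraph :: "('v, 'e) multigraph \<Rightarrow> bool" where
  "acyclic_multigraph G \<longleftrightarrow> (\<nexists>vs es. is_cycle G vs es)"

text \<open>The empty graph is not connected; hence the empty conjunction is not a connected CQ.\<close>

definition connected_multigraph :: "('v, 'e) multigraph \<Rightarrow> bool" where
  "connected_multigraph G \<longleftrightarrow> nodes G \<noteq> {} \<and>
     (\<forall>u\<in>nodes G. \<forall>v\<in>nodes G. (u, v) \<in> {(a, b). \<exists>e\<in>edges G. ends G e = {a, b}}\<^sup>*)"

datatype 'a inode = Elem 'a | Fact "'a \<times> 'a"

datatype position = First | Second

text \<open>The edges are the occurrences, i.e. pairs of a fact and a position in it; a fact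
  \<open>(x, x)\<close> gives rise to two parallel edges.\<close>

fun occ_ends :: "('a \<times> 'a) \<times> position \<Rightarrow> 'a inode set" where
  "occ_ends ((x, y), First) = {Elem x, Fact (x, y)}"
| "occ_ends ((x, y), Second) = {Elem y, Fact (x, y)}"

definition incidence_graph :: "'a rstruct \<Rightarrow> ('a inode, ('a \<times> 'a) \<times> position) multigraph" where
  "incidence_graph A =
     \<lparr>nodes = Elem ` dom_of A \<union> Fact ` facts A, edges = facts A \<times> UNIV, ends = occ_ends\<rparr>"

definition acyclic_structure :: "'a rstruct \<Rightarrow> bool" where
  "acyclic_structure A \<longleftrightarrow> acyclic_multigraph (incidence_graph A)"

definition connected_structure :: "'a rstruct \<Rightarrow> bool" where
  "connected_structure A \<longleftrightarrow> connected_multigraph (incidence_graph A)"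

definition acyclic_connected_cqs :: "bcq set" where
  "acyclic_connected_cqs =
     {q. acyclic_structure (canonical q) \<and> connected_structure (canonical q)}"


section \<open>Unique characterizations\<close>

definition fits :: "'a rstruct set \<Rightarrow> 'a rstruct set \<Rightarrow> bcq \<Rightarrow> bool" where
  "fits Epos Eneg q \<longleftrightarrow> (\<forall>A\<in>Epos. holds_in q A) \<and> (\<forall>A\<in>Eneg. \<not> holds_in q A)"

definition uniquely_characterizes ::
    "'a rstruct set \<Rightarrow> 'a rstruct set \<Rightarrow> bcq \<Rightarrow> bcq set \<Rightarrow> bool" where
  "uniquely_characterizes Epos Eneg q C \<longleftrightarrow>
     fits Epos Eneg q \<and> (\<forall>q'\<in>C. fits Epos Eneg q' \<longrightarrow> logically_equivalent q' q)"

definition T :: bcq where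
  "T = [R 1 2, R 2 3, R 3 4, R 4 5]"

end

theory Submission imports Defs
begin

text \<open>
  Take a long zigzag \<open>\<rightarrow>\<rightarrow>\<leftarrow>\<leftarrow>\<rightarrow>\<rightarrow>\<leftarrow>\<leftarrow>\<cdots>\<close> and attach an outgoing path of length 2 to the midpoint
  of every forward stretch and an incoming one to the midpoint of every backward stretch. This
  query maps to \<open>T\<close> and contains no directed path of length 4, so it fits the positive
  examples and is not equivalent to \<open>T\<close>. Under a homomorphism into a structure in which \<open>T\<close>
  fails, the two midpoints adjacent to a turning point have distinct images, as otherwise the
  attached paths would form a directed path of length 4. Hence the image of the zigzag is a walk
  without backtracking; in an acyclic structure such a walk is injective, so a zigzag with more
  vertices than each negative example fits the negative examples as well.
\<close>

section \<open>Cycles in incidence graphs\<close>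

text \<open>On a cycle, a vertex of maximal rank is the apex of both of its cycle edges, so
  injectivity of \<open>apex\<close> identifies them. Loops are excluded because the other endpoint
  has strictly smaller rank.\<close>

lemma acyclic_multigraph_if_ranked:
  fixes rank :: "'v \<Rightarrow> nat"
  assumes inj: "inj_on apex (edges G)"
    and ends: "\<And>e. e \<in> edges G \<Longrightarrow> \<exists>u. ends G e = {apex e, u} \<and> rank u < rank (apex e)"
  shows "acyclic_multigraph G"
  unfolding acyclic_multigraph_def
proof (intro notI, elim exE)
  fix vs es
  assume "is_cycle G vs es"
  then have ne: "es \<noteq> []" and de: "distinct es"
    and es: "set es \<subseteq> edges G"
    and E: "\<And>i. i < length es \<Longrightarrow> ends G (es ! i) = {vs ! i, vs ! (Suc i mod length es)}"
    by (auto simp: is_cycle_def)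
  let ?n = "length es"
  have n: "?n > 0" using ne by simp
  have "Max ((\<lambda>i. rank (vs ! i)) ` {..<?n}) \<in> (\<lambda>i. rank (vs ! i)) ` {..<?n}"
    using n by (intro Max_in) auto
  then obtain m where m: "m < ?n" and
    mx: "rank (vs ! m) = Max ((\<lambda>i. rank (vs ! i)) ` {..<?n})" by auto
  have mmax: "rank (vs ! i) \<le> rank (vs ! m)" if "i < ?n" for i
    unfolding mx using that by (intro Max_ge) auto
  have topm: "apex (es ! i) = vs ! m" "vs ! i \<noteq> vs ! (Suc i mod ?n)"
    if "i < ?n" "vs ! m \<in> ends G (es ! i)" for i
  proof -
    have "es ! i \<in> edges G" using es that(1) by auto
    then obtain u where u: "ends G (es ! i) = {apex (es ! i), u}" "rank u < rank (apex (es ! i))"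
      using ends by blast
    have "Suc i mod ?n < ?n" using n by simp
    then have "rank (apex (es ! i)) \<le> rank (vs ! m)"
      using E[OF that(1)] u(1) mmax that(1) by (metis insertE insertI1 singletonD)
    then show "apex (es ! i) = vs ! m" using u that(2) by auto
    show "vs ! i \<noteq> vs ! (Suc i mod ?n)" using E[OF that(1)] u
      by (metis doubleton_eq_iff insert_absorb2 less_irrefl)
  qed
  \<comment> \<open>\<open>p\<close> is the cyclic predecessor of \<open>m\<close>, so
    \<open>es ! p\<close> and \<open>es ! m\<close> are the cycle edges at \<open>vs ! m\<close>.
    They coincide only if \<open>m = p\<close>, which makes the edge a loop.\<close>
  define p where "p = (if m = 0 then ?n - 1 else m - 1)"
  have p: "p < ?n" "Suc p mod ?n = m" using m n by (auto simp: p_def)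
  have t: "apex (es ! m) = vs ! m" "apex (es ! p) = vs ! m" "vs ! m \<noteq> vs ! (Suc m mod ?n)"
    using topm[OF m] topm[OF p(1)] E[OF m] E[OF p(1)] p(2) by auto
  then have "es ! m = es ! p" using inj es m p(1) by (metis inj_onD nth_mem subsetD)
  then have "m = p" using de m p(1) by (simp add: nth_eq_iff_index_eq)
  then show False using t(3) p(2) by simp
qed

definition step_fact :: "bool \<Rightarrow> 'a \<Rightarrow> 'a \<Rightarrow> 'a \<times> 'a" where
  "step_fact fwd x y = (if fwd then (x, y) else (y, x))"

text \<open>The walk lifts to a cycle of length \<open>2 * n\<close> in the incidence graph that
  alternates between elements and facts. The case \<open>n = 1\<close> is a fact
  \<open>(x, x)\<close> with its two parallel edges.\<close>

lemma closed_walk_not_acyclic: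
  assumes n: "n > 0" and inj: "inj_on w {..<n}" and closed: "w n = w 0"
    and f: "\<And>k. k < n \<Longrightarrow> step_fact (d k) (w k) (w (Suc k)) \<in> facts A"
    and inj_f: "inj_on (\<lambda>k. step_fact (d k) (w k) (w (Suc k))) {..<n}"
    and dom: "facts A \<subseteq> dom_of A \<times> dom_of A"
  shows "\<not> acyclic_structure A"
proof -
  define f where "f k = step_fact (d k) (w k) (w (Suc k))" for k
  define V where "V l = (if even l then Elem (w (l div 2)) else Fact (f (l div 2)))" for l
  \<comment> \<open>Edge \<open>l\<close> of the cycle leaves an element for even \<open>l\<close>
    and enters the next one for odd \<open>l\<close>; traversing a fact against its direction swaps
    the positions.\<close>
  define P where "P l = (if d (l div 2) = even l then First else Second)" for l
  define Eg where "Eg l = (f (l div 2), P l)" for l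
  have half: "l div 2 < n" if "l < 2 * n" for l using that by auto
  have ff: "f k \<in> facts A" if "k < n" for k using f that by (simp add: f_def)
  have parity: "l = l'" if "l div 2 = l' div 2" "even l = even l'" for l l' :: nat
    using that by presburger
  have w_dom: "w k \<in> dom_of A" if "k < n" for k
    using ff[OF that] dom by (auto simp: f_def step_fact_def split: if_splits)
  have injV: "inj_on V {..<2 * n}"
  proof (rule inj_onI)
    fix l l' assume "l \<in> {..<2 * n}" "l' \<in> {..<2 * n}" "V l = V l'"
    then show "l = l'"
      using inj_onD[OF inj, of "l div 2" "l' div 2"] inj_onD[OF inj_f, of "l div 2" "l' div 2"]
        half[of l] half[of l'] parity[of l l']
      by (auto simp: V_def f_def split: if_splits)
  qed
  have injE: "inj_on Eg {..<2 * n}"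
  proof (rule inj_onI)
    fix l l' assume l: "l \<in> {..<2 * n}" "l' \<in> {..<2 * n}" and eq: "Eg l = Eg l'"
    have "l div 2 = l' div 2"
      using inj_onD[OF inj_f, of "l div 2" "l' div 2"] eq l half[of l] half[of l']
      by (auto simp: Eg_def f_def)
    moreover from this have "even l = even l'"
      using eq by (simp add: Eg_def P_def split: if_splits)
    ultimately show "l = l'" by (rule parity)
  qed
  have next_odd: "V (Suc l mod (2 * n)) = Elem (w (Suc (l div 2)))" if "l < 2 * n" "odd l" for l
  proof (cases "Suc l = 2 * n")
    case True
    then have "Suc (l div 2) = n" using that(2) by presburger
    then show ?thesis using True closed by (simp add: V_def)
  next
    case False
    then have "Suc l < 2 * n" using that by simp
    moreover have "Suc l div 2 = Suc (l div 2)" using that(2) by presburger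
    ultimately show ?thesis using that(2) by (simp add: V_def)
  qed
  have next_even: "V (Suc l mod (2 * n)) = Fact (f (l div 2))" if "l < 2 * n" "even l" for l
  proof -
    have "Suc l < 2 * n" "Suc l div 2 = l div 2" using that by presburger+
    then show ?thesis using that(2) by (simp add: V_def)
  qed
  have ends: "occ_ends (Eg l) = {V l, V (Suc l mod (2 * n))}" if "l < 2 * n" for l
    using next_odd[OF that] next_even[OF that]
    by (cases "even l"; cases "d (l div 2)")
      (auto simp: V_def Eg_def P_def f_def step_fact_def)
  have "is_cycle (incidence_graph A) (map V [0..<2 * n]) (map Eg [0..<2 * n])"
    using n injV injE ends half ff w_dom
    by (auto simp: is_cycle_def incidence_graph_def distinct_map atLeast0LessThan
        V_def Eg_def)
  then show ?thesis
    unfolding acyclic_structure_def acyclic_multigraph_def by blast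
qed

text \<open>A shortest return of the walk to an earlier element would be a closed walk with distinct
  elements. Its facts are distinct too: two equal ones would have to be consecutive, which
  \<open>reduced\<close> forbids.\<close>

lemma reduced_walk_inj_on:
  assumes acyc: "acyclic_structure A" and dom: "facts A \<subseteq> dom_of A \<times> dom_of A"
    and f: "\<And>k. Suc k < N \<Longrightarrow> step_fact (d k) (w k) (w (Suc k)) \<in> facts A"
    and reduced: "\<And>k. Suc (Suc k) < N \<Longrightarrow>
      step_fact (d k) (w k) (w (Suc k)) \<noteq> step_fact (d (Suc k)) (w (Suc k)) (w (Suc (Suc k)))"
  shows "inj_on w {..<N}"
proof (rule ccontr)
  assume "\<not> inj_on w {..<N}"
  then obtain i j where ij: "i < j" "j < N" "w i = w j"
    by (metis linorder_inj_onI lessThan_iff linear)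
  \<comment> \<open>The return length is minimized over all starting points at once, so no proper
    part of the segment found can return.\<close>
  define Q where "Q n \<longleftrightarrow> (\<exists>i. 0 < n \<and> i + n < N \<and> w (i + n) = w i)" for n
  define n where "n = (LEAST n. Q n)"
  have "Q (j - i)" unfolding Q_def using ij by (intro exI[of _ i]) auto
  then have "Q n" unfolding n_def by (rule LeastI)
  then obtain i where i: "0 < n" "i + n < N" "w (i + n) = w i" by (auto simp: Q_def)
  have min: "w (i + a) \<noteq> w (i + b)" if "a < b" "b < n" for a b
  proof
    assume "w (i + a) = w (i + b)"
    then have "Q (b - a)" unfolding Q_def using that i by (intro exI[of _ "i + a"]) auto
    then have "n \<le> b - a" unfolding n_def by (rule Least_le)
    with that show False by simp
  qed
  have "inj_on (\<lambda>k. w (i + k)) {..<n}"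
    by (rule linorder_inj_onI) (use min in auto)
  moreover have "inj_on (\<lambda>k. step_fact (d (i + k)) (w (i + k)) (w (i + Suc k))) {..<n}"
  proof (rule linorder_inj_onI)
    fix k l assume kl: "k < l" "k \<in> {..<n}" "l \<in> {..<n}"
    show "step_fact (d (i + k)) (w (i + k)) (w (i + Suc k)) \<noteq>
        step_fact (d (i + l)) (w (i + l)) (w (i + Suc l))" (is "?a \<noteq> ?b")
    proof
      assume eq: "?a = ?b"
      then have "w (i + l) = w (i + k) \<or> w (i + l) = w (i + Suc k)"
        by (auto simp: step_fact_def split: if_splits)
      then have "l = Suc k" using min[of k l] min[of "Suc k" l] kl
        by (metis Suc_lessI lessThan_iff)
      then show False using reduced[of "i + k"] eq i kl by auto
    qed
  qed auto
  moreover have "step_fact (d (i + k)) (w (i + k)) (w (i + Suc k)) \<in> facts A" if "k < n" for k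
    using f[of "i + k"] that i by simp
  ultimately have "\<not> acyclic_structure A"
    using i dom closed_walk_not_acyclic[of n "\<lambda>k. w (i + k)" "\<lambda>k. d (i + k)" A] by simp
  with acyc show False by contradiction
qed


section \<open>Caterpillar queries\<close>

text \<open>Vertex \<open>3 * i\<close> is the \<open>i\<close>-th vertex of the zigzag; \<open>3 * i + 1\<close> and \<open>3 * i + 2\<close> form the path
  attached to it. Attaching paths to the turning points as well makes the orientation of
  an edge depend only on the number \<open>i\<close> of the block in which it starts.\<close>

definition parent :: "nat \<Rightarrow> nat" where
  "parent x = (if x mod 3 = 0 then x - 3 else x - 1)"

definition forward :: "nat \<Rightarrow> bool" where
  "forward i \<longleftrightarrow> i mod 4 < 2"

definition parent_fact :: "nat \<Rightarrow> nat \<times> nat" where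
  "parent_fact x = step_fact (forward (parent x div 3)) (parent x) x"

definition caterpillar :: "nat \<Rightarrow> bcq" where
  "caterpillar N = map (\<lambda>x. case parent_fact x of (a, b) \<Rightarrow> R a b) [1..<3 * N]"

lemma parent_less: "x > 0 \<Longrightarrow> parent x < x"
  by (cases "x mod 3 = 0") (simp_all add: parent_def)

lemma facts_caterpillar: "facts (canonical (caterpillar N)) = parent_fact ` {1..<3 * N}"
proof -
  have "R a b = (case p of (a, b) \<Rightarrow> R a b) \<longleftrightarrow> (a, b) = p" for a b p
    by (cases p) simp
  then show ?thesis
    by (auto simp: canonical_def caterpillar_def image_iff)
qed

lemma facts_caterpillarE:
  assumes "(a, b) \<in> facts (canonical (caterpillar N))"
  obtains x where "x > 0" "parent_fact x = (a, b)"
proof -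
  obtain x where "(a, b) = parent_fact x" "x \<in> {1..<3 * N}"
    using assms unfolding facts_caterpillar by (rule imageE)
  then show ?thesis using that[of x] by simp
qed

lemma vars_caterpillar:
  assumes "N > 0"
  shows "vars (caterpillar N) = {..<3 * N}"
proof -
  have "atom_vars (case parent_fact x of (a, b) \<Rightarrow> R a b) = {parent x, x}" for x
    by (simp add: parent_fact_def step_fact_def insert_commute)
  then have "vars (caterpillar N) = (\<Union>x\<in>{1..<3 * N}. {parent x, x})"
    by (simp add: vars_def caterpillar_def)
  also have "\<dots> = {..<3 * N}"
  proof (intro equalityI subsetI)
    fix x assume "x \<in> {..<3 * N}"
    \<comment> \<open>Vertex 0 occurs only as a parent, since the atoms are indexed from 1.\<close>
    moreover have "parent 1 = 0" by (simp add: parent_def)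
    moreover have "1 \<in> {1..<3 * N}" using assms by simp
    ultimately show "x \<in> (\<Union>x\<in>{1..<3 * N}. {parent x, x})"
      by (cases "x = 0") (force, auto)
  next
    fix x assume "x \<in> (\<Union>x\<in>{1..<3 * N}. {parent x, x})"
    then obtain z where "z \<in> {1..<3 * N}" "x = parent z \<or> x = z" by blast
    then show "x \<in> {..<3 * N}" using parent_less[of z] by auto
  qed
  finally show ?thesis .
qed

lemma finite_structure_caterpillar: "finite_structure (canonical (caterpillar N))"
proof -
  have "finite (atom_vars a)" for a by (cases a) simp
  moreover have "{(x, y). R x y \<in> set q} \<subseteq> vars q \<times> vars q" for q
    unfolding vars_def by force
  ultimately show ?thesis
    by (simp add: finite_structure_def canonical_def vars_def)
qed

text \<open>For \<open>N > 0\<close> the incidence graph is a tree rooted at \<open>Elem 0\<close>.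
  The apex of an edge is its endpoint farther from the root, and each node has at most one edge
  towards the root.\<close>

lemma acyclic_caterpillar: "acyclic_structure (canonical (caterpillar N))"
  unfolding acyclic_structure_def
proof (rule acyclic_multigraph_if_ranked)
  \<comment> \<open>In \<open>parent_fact x = (a, b)\<close> the child \<open>x\<close> is
    \<open>max a b\<close>. The edge at the parent has the fact as its apex, the edge at the child
    has the child.\<close>
  define apex :: "(nat \<times> nat) \<times> position \<Rightarrow> nat inode" where
    "apex e = (case e of ((a, b), p) \<Rightarrow>
      if (a < b) = (p = First) then Fact (a, b) else Elem (max a b))" for e
  \<comment> \<open>Doubling leaves room for the fact at \<open>2 * x - 1\<close>, between
    \<open>parent x\<close> and \<open>x\<close>.\<close>
  define rank :: "nat inode \<Rightarrow> nat" where
    "rank v = (case v of Elem x \<Rightarrow> 2 * x | Fact (a, b) \<Rightarrow> 2 * max a b - 1)" for v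
  let ?G = "incidence_graph (canonical (caterpillar N))"
  have edge: "\<exists>x p. x > 0 \<and> e = (parent_fact x, p)" if "e \<in> edges ?G" for e
  proof -
    obtain a b p where e: "e = ((a, b), p)" by (metis surj_pair)
    then have "(a, b) \<in> facts (canonical (caterpillar N))"
      using that by (simp add: incidence_graph_def)
    then show ?thesis using e by (metis facts_caterpillarE)
  qed
  show "inj_on apex (edges ?G)"
  proof (rule inj_onI)
    fix e e' assume e: "e \<in> edges ?G" "e' \<in> edges ?G" and eq: "apex e = apex e'"
    obtain x p y p' where xy: "x > 0" "e = (parent_fact x, p)" "y > 0" "e' = (parent_fact y, p')"
      using edge e by metis
    note less = parent_less[OF xy(1)] parent_less[OF xy(3)]
    have "x = y"
      using eq less unfolding xy apex_def parent_fact_def step_fact_def max_def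
      by (auto split: if_splits)
    then show "e = e'"
      using eq less unfolding xy apex_def parent_fact_def step_fact_def
      by (cases p; cases p') (simp_all split: if_splits)
  qed
  fix e assume "e \<in> edges ?G"
  then obtain x p where x: "x > 0" "e = (parent_fact x, p)" using edge by blast
  define c where "c = Fact (parent_fact x)"
  have "ends ?G e = {Elem x, c} \<and> apex e = Elem x \<or> ends ?G e = {c, Elem (parent x)} \<and> apex e = c"
    using parent_less[OF x(1)] unfolding x c_def
    by (cases p; cases "forward (parent x div 3)")
      (simp_all add: incidence_graph_def apex_def parent_fact_def step_fact_def max_def
        insert_commute)
  moreover have "rank c < rank (Elem x)" "rank (Elem (parent x)) < rank c"
    using parent_less[OF x(1)]
    by (auto simp: c_def rank_def parent_fact_def step_fact_def max_def)
  ultimately show "\<exists>u. ends ?G e = {apex e, u} \<and> rank u < rank (apex e)"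
    by auto
qed

text \<open>Every element reaches \<open>Elem 0\<close> by following parents, through the facts that
  join them.\<close>

lemma connected_caterpillar:
  assumes N: "N > 0"
  shows "connected_structure (canonical (caterpillar N))"
proof -
  let ?G = "incidence_graph (canonical (caterpillar N))"
  let ?r = "{(a, b). \<exists>e\<in>edges ?G. ends ?G e = {a, b}}"
  have step: "(Elem a, Fact (a, b)) \<in> ?r" "(Elem b, Fact (a, b)) \<in> ?r"
    if "(a, b) \<in> facts (canonical (caterpillar N))" for a b
  proof -
    have "((a, b), p) \<in> edges ?G" for p using that by (simp add: incidence_graph_def)
    moreover have "ends ?G ((a, b), First) = {Elem a, Fact (a, b)}"
      "ends ?G ((a, b), Second) = {Elem b, Fact (a, b)}" by (simp_all add: incidence_graph_def)
    ultimately show "(Elem a, Fact (a, b)) \<in> ?r" "(Elem b, Fact (a, b)) \<in> ?r" by blast+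
  qed
  have sym: "sym (?r\<^sup>*)"
    by (intro sym_rtrancl) (auto simp: sym_def insert_commute)
  have fact: "(Elem x, Fact (parent_fact x)) \<in> ?r" "(Elem (parent x), Fact (parent_fact x)) \<in> ?r"
    if "x \<in> {1..<3 * N}" for x
  proof -
    have "parent_fact x \<in> facts (canonical (caterpillar N))"
      unfolding facts_caterpillar using that by (rule imageI)
    then show "(Elem x, Fact (parent_fact x)) \<in> ?r" "(Elem (parent x), Fact (parent_fact x)) \<in> ?r"
      using step unfolding parent_fact_def step_fact_def by presburger+
  qed
  have root: "(Elem x, Elem 0) \<in> ?r\<^sup>*" if "x < 3 * N" for x
    using that
  proof (induction x rule: less_induct)
    case (less x)
    show ?case
    proof (cases "x = 0")
      case False
      then have x: "x \<in> {1..<3 * N}" using less.prems by simp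
      have "(Elem x, Fact (parent_fact x)) \<in> ?r\<^sup>*" using fact(1)[OF x] by (rule r_into_rtrancl)
      also have "(Fact (parent_fact x), Elem (parent x)) \<in> ?r\<^sup>*"
        using fact(2)[OF x] sym by (meson r_into_rtrancl symD)
      also have "(Elem (parent x), Elem 0) \<in> ?r\<^sup>*"
        using less False parent_less[of x] by simp
      finally show ?thesis .
    qed simp
  qed
  have all: "(v, Elem 0) \<in> ?r\<^sup>*" if v: "v \<in> nodes ?G" for v
  proof -
    consider x where "v = Elem x" "x < 3 * N" | x where "v = Fact (parent_fact x)" "x \<in> {1..<3 * N}"
      using v by (auto simp: incidence_graph_def facts_caterpillar)
        (auto simp: canonical_def vars_caterpillar[OF N])
    then show ?thesis
    proof cases
      case 2
      then have "(v, Elem x) \<in> ?r\<^sup>*" using fact(1) sym by (meson r_into_rtrancl symD)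
      also have "(Elem x, Elem 0) \<in> ?r\<^sup>*" using root 2 by simp
      finally show ?thesis .
    qed (use root in simp)
  qed
  have "Elem 0 \<in> nodes ?G"
    using N by (simp add: incidence_graph_def canonical_def vars_caterpillar)
  then have "nodes ?G \<noteq> {}" by blast
  moreover have "(u, v) \<in> ?r\<^sup>*" if "u \<in> nodes ?G" "v \<in> nodes ?G" for u v
    using all that sym by (meson rtrancl_trans symD)
  ultimately show ?thesis
    unfolding connected_structure_def connected_multigraph_def by blast
qed

text \<open>\<open>level 1\<close> is used as a homomorphism to the path of length 4, and \<open>level 0\<close> as a strictly
  increasing labelling that rules out directed paths of length 4.\<close>

definition level :: "nat \<Rightarrow> nat \<Rightarrow> nat" where
  "level c x = (let b = x div 3 mod 4 in
     if b < 2 then c + b + x mod 3 else 5 - b - x mod 3)"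

text \<open>For \<open>c = 1\<close> every edge climbs by exactly one. For \<open>c = 0\<close> the
  forward blocks drop by one: edges between a forward and a backward block then climb by two, and
  the range shrinks to 0..3.\<close>

lemma level_parent_fact:
  assumes "x > 0" and "parent_fact x = (a, b)"
  shows "level 1 b = Suc (level 1 a)" and "level 1 b \<le> 4"
    and "level 0 a < level 0 b" and "level 0 b \<le> 3"
proof -
  define i where "i = parent x div 3"
  define m where "m = i mod 4"
  have m: "m = 0 \<or> m = 1 \<or> m = 2 \<or> m = 3" unfolding m_def by linarith
  have "parent x = 3 * i \<and> x = 3 * i + 3 \<or> parent x = 3 * i \<and> x = 3 * i + 1 \<or>
      parent x = 3 * i + 1 \<and> x = 3 * i + 2"
    using assms(1) unfolding i_def parent_def
    by (cases "x mod 3 = 0"; simp only: if_True if_False refl; presburger)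
  moreover have "(a, b) = (if m < 2 then (parent x, x) else (x, parent x))"
    using assms(2) by (simp add: parent_fact_def step_fact_def forward_def i_def m_def)
  moreover
  have L: "level c (3 * i + r) = (if m < 2 then c + m + r else 5 - m - r)" if "r < 3" for c r
  proof -
    have "(3 * i + r) div 3 = i" "(3 * i + r) mod 3 = r" using that by presburger+
    then show ?thesis by (simp add: level_def m_def)
  qed
  have "level c (3 * i) = (if m < 2 then c + m else 5 - m)"
    "level c (3 * i + 1) = (if m < 2 then c + m + 1 else 4 - m)"
    "level c (3 * i + 2) = (if m < 2 then c + m + 2 else 3 - m)" for c
    using L[of 0 c] L[of 1 c] L[of 2 c] by simp_all
  \<comment> \<open>Only the zigzag edge leaves its block. The next block has residue
    \<open>m + 1\<close>, wrapping to 0 for \<open>m = 3\<close>.\<close>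
  moreover have "level c (3 * i + 3) =
      (if m = 3 then c else if m = 0 then c + 1 else 4 - m)" for c
  proof -
    have "(3 * i + 3) div 3 = Suc i" "(3 * i + 3) mod 3 = 0" by presburger+
    then show ?thesis using m by (auto simp: level_def m_def mod_Suc)
  qed
  ultimately have "level 1 b = Suc (level 1 a) \<and> level 1 b \<le> 4 \<and> level 0 a < level 0 b \<and> level 0 b \<le> 3"
    using m by (elim disjE conjE) simp_all
  then show "level 1 b = Suc (level 1 a)" "level 1 b \<le> 4" "level 0 a < level 0 b" "level 0 b \<le> 3"
    by auto
qed


section \<open>The query T and the caterpillars\<close>

lemma holds_in_T_iff:
  fixes A :: "'a rstruct"
  assumes "facts A \<subseteq> dom_of A \<times> dom_of A"
  shows "holds_in T A \<longleftrightarrow>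
    (\<exists>a b c d e. (a, b) \<in> facts A \<and> (b, c) \<in> facts A \<and> (c, d) \<in> facts A \<and> (d, e) \<in> facts A)"
proof
  assume "\<exists>a b c d e. (a, b) \<in> facts A \<and> (b, c) \<in> facts A \<and> (c, d) \<in> facts A \<and> (d, e) \<in> facts A"
  then obtain a b c d e where
    p: "(a, b) \<in> facts A" "(b, c) \<in> facts A" "(c, d) \<in> facts A" "(d, e) \<in> facts A" by blast
  then have "{a, b, c, d, e} \<subseteq> dom_of A" using assms by auto
  with p show "holds_in T A"
    unfolding holds_in_def T_def vars_def
    \<comment> \<open>The variables of \<open>T\<close> are 1 to 5, so the entry at index 0 is
      padding.\<close>
    by (intro exI[of _ "\<lambda>n. [a, a, b, c, d, e] ! n"]) (simp add: numeral_eq_Suc)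
next
  assume "holds_in T A"
  then obtain s :: "nat \<Rightarrow> 'a" where "(s 1, s 2) \<in> facts A" "(s 2, s 3) \<in> facts A" "(s 3, s 4) \<in> facts A"
    "(s 4, s 5) \<in> facts A"
    by (auto simp: holds_in_def T_def)
  then show "\<exists>a b c d e. (a, b) \<in> facts A \<and> (b, c) \<in> facts A \<and> (c, d) \<in> facts A \<and> (d, e) \<in> facts A"
    by blast
qed

text \<open>Along a directed path of length 4, \<open>level 0\<close> would take five increasing
  values in 0..3.\<close>

lemma not_holds_in_T_caterpillar: "\<not> holds_in T (canonical (caterpillar N))"
proof
  assume "holds_in T (canonical (caterpillar N))"
  then obtain a b c d e where "(a, b) \<in> facts (canonical (caterpillar N))"
    "(b, c) \<in> facts (canonical (caterpillar N))" "(c, d) \<in> facts (canonical (caterpillar N))"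
    "(d, e) \<in> facts (canonical (caterpillar N))"
    using holds_in_T_iff finite_structure_caterpillar unfolding finite_structure_def by blast
  moreover have "level 0 x < level 0 y \<and> level 0 y \<le> 3"
    if xy: "(x, y) \<in> facts (canonical (caterpillar N))" for x y
  proof -
    obtain z where "z > 0" "parent_fact z = (x, y)" using xy by (rule facts_caterpillarE)
    then show ?thesis using level_parent_fact(3,4) by blast
  qed
  ultimately have "level 0 a < level 0 b" "level 0 b < level 0 c" "level 0 c < level 0 d"
    "level 0 d < level 0 e" "level 0 e \<le> 3" by blast+
  then show False by linarith
qed

text \<open>\<open>level 1\<close> folds the caterpillar onto a path of length 4, and
  \<open>T\<close> provides the image of such a path in \<open>A\<close>.\<close>

lemma holds_in_caterpillar:
  assumes "holds_in T A" and dom: "facts A \<subseteq> dom_of A \<times> dom_of A"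
  shows "holds_in (caterpillar N) A"
proof -
  obtain a b c d e where
    p: "(a, b) \<in> facts A" "(b, c) \<in> facts A" "(c, d) \<in> facts A" "(d, e) \<in> facts A"
    using assms holds_in_T_iff by blast
  define y where "y n = [a, b, c, d, e] ! n" for n
  have y: "(y n, y (Suc n)) \<in> facts A" if "Suc n \<le> 4" for n
  proof -
    have "n = 0 \<or> n = 1 \<or> n = 2 \<or> n = 3" using that by linarith
    then show ?thesis using p by (auto simp: y_def)
  qed
  have f: "(y (level 1 u), y (level 1 v)) \<in> facts A"
    if uv: "(u, v) \<in> facts (canonical (caterpillar N))" for u v
  proof -
    obtain x where "x > 0" "parent_fact x = (u, v)" using uv by (rule facts_caterpillarE)
    then show ?thesis using level_parent_fact(1,2)[of x u v] y[of "level 1 u"] by simp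
  qed
  have "y (level 1 u) \<in> dom_of A" if u: "u \<in> dom_of (canonical (caterpillar N))" for u
  proof -
    obtain at where at: "at \<in> set (caterpillar N)" "u \<in> atom_vars at"
      using u by (auto simp: canonical_def vars_def)
    obtain v v' where "at = R v v'" by (cases at)
    with at have "(v, v') \<in> facts (canonical (caterpillar N))" "u = v \<or> u = v'"
      by (auto simp: canonical_def)
    then show ?thesis using f dom by blast
  qed
  then show ?thesis
    unfolding holds_in_iff_hom is_hom_def using f by (intro exI[of _ "\<lambda>x. y (level 1 x)"]) auto
qed

lemma not_holds_in_caterpillar:
  assumes A: "finite_structure A" "acyclic_structure A" and T: "\<not> holds_in T A"
    and N: "card (dom_of A) < N"
  shows "\<not> holds_in (caterpillar N) A"
proof
  assume "holds_in (caterpillar N) A"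
  then obtain h where h: "is_hom h (canonical (caterpillar N)) A" by (auto simp: holds_in_iff_hom)
  have dom: "facts A \<subseteq> dom_of A \<times> dom_of A" using A(1) by (simp add: finite_structure_def)
  have no_path: False
    if "(a, b) \<in> facts A" "(b, c) \<in> facts A" "(c, d) \<in> facts A" "(d, e) \<in> facts A" for a b c d e
    using that T holds_in_T_iff[OF dom] by blast
  have hf: "step_fact (forward (parent x div 3)) (h (parent x)) (h x) \<in> facts A"
    if "0 < x" "x < 3 * N" for x
  proof -
    have "parent_fact x \<in> facts (canonical (caterpillar N))"
      unfolding facts_caterpillar using that by auto
    then show ?thesis using h by (auto simp: is_hom_def parent_fact_def step_fact_def split: if_splits)
  qed
  define w where "w i = h (3 * i)" for i
  have par: "parent (3 * Suc i) = 3 * i" "parent (3 * i + 1) = 3 * i" "parent (3 * i + 2) = 3 * i + 1"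
    "(3 * i + 1) div 3 = i" for i
    unfolding parent_def by (simp; presburger)+
  have walk: "step_fact (forward i) (w i) (w (Suc i)) \<in> facts A" if "Suc i < N" for i
    using hf[of "3 * Suc i"] that unfolding par by (simp add: w_def)
  have tail: "step_fact (forward i) (w i) (h (3 * i + 1)) \<in> facts A"
    "step_fact (forward i) (h (3 * i + 1)) (h (3 * i + 2)) \<in> facts A" if "i < N" for i
    using hf[of "3 * i + 1"] hf[of "3 * i + 2"] that unfolding par by (simp_all add: w_def)
  \<comment> \<open>If they were equal, the path of length 2 into \<open>w j\<close> followed by the
    one out of \<open>w i\<close> would make \<open>T\<close> hold.\<close>
  have crossing: "w i \<noteq> w j" if "i < N" "j < N" "forward i" "\<not> forward j" for i j
    using tail[of i] tail[of j] that no_path by (auto simp: step_fact_def)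
  have "inj_on w {..<N}"
  proof (rule reduced_walk_inj_on[OF A(2) dom, of N forward])
    fix k assume k: "Suc (Suc k) < N"
    \<comment> \<open>Equal consecutive facts mean a loop if both steps have the same direction, and
      \<open>w k = w (k + 2)\<close> otherwise. A loop makes \<open>T\<close> hold; blocks
      \<open>k\<close> and \<open>k + 2\<close> always have opposite directions, so
      \<open>crossing\<close> excludes the other case.\<close>
    have turn: "forward (Suc (Suc k)) \<longleftrightarrow> \<not> forward k"
      unfolding forward_def by presburger
    have noloop: "(a, a) \<notin> facts A" for a using no_path by blast
    show "step_fact (forward k) (w k) (w (Suc k)) \<noteq>
        step_fact (forward (Suc k)) (w (Suc k)) (w (Suc (Suc k)))"
      using walk[of k] noloop crossing[of k "Suc (Suc k)"] crossing[of "Suc (Suc k)" k] turn k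
      by (auto simp: step_fact_def split: if_splits)
  qed (rule walk)
  moreover have "w ` {..<N} \<subseteq> dom_of A"
    using h N by (auto simp: is_hom_def canonical_def vars_caterpillar w_def)
  ultimately have "N \<le> card (dom_of A)"
    using A(1) card_inj_on_le[of w "{..<N}"] by (simp add: finite_structure_def)
  with N show False by simp
qed

theorem theorem4p7:
  shows "\<nexists>(Epos :: 'a rstruct set) (Eneg :: 'a rstruct set).
           finite Epos \<and> finite Eneg \<and>
           (\<forall>A\<in>Epos \<union> Eneg. finite_structure A \<and> acyclic_structure A) \<and>
           uniquely_characterizes Epos Eneg T acyclic_connected_cqs"
proof (intro notI, elim exE conjE)
  fix Epos Eneg :: "'a rstruct set"
  assume fin: "finite Eneg"
    and A: "\<forall>A\<in>Epos \<union> Eneg. finite_structure A \<and> acyclic_structure A"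
    and uc: "uniquely_characterizes Epos Eneg T acyclic_connected_cqs"
  \<comment> \<open>The sum bounds each summand; the successor makes the bound strict, and
    \<open>N\<close> positive even if \<open>Eneg\<close> is empty, so that the query is
    connected.\<close>
  define N where "N = Suc (\<Sum>A\<in>Eneg. card (dom_of A))"
  let ?q = "caterpillar N"
  have N: "card (dom_of A) < N" if "A \<in> Eneg" for A
    using member_le_sum[OF that, of "\<lambda>A. card (dom_of A)"] fin by (simp add: N_def)
  have "fits Epos Eneg T" using uc by (simp add: uniquely_characterizes_def)
  then have "fits Epos Eneg ?q"
    using A N holds_in_caterpillar not_holds_in_caterpillar
    unfolding fits_def finite_structure_def by (metis UnCI finite_structure_def)
  moreover have "?q \<in> acyclic_connected_cqs"
    by (simp add: acyclic_connected_cqs_def acyclic_caterpillar connected_caterpillar N_def)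
  ultimately have "logically_equivalent ?q T" using uc by (simp add: uniquely_characterizes_def)
  \<comment> \<open>The canonical structure of the query itself separates it from
    \<open>T\<close>.\<close>
  moreover have "holds_in ?q (canonical ?q)"
    unfolding holds_in_iff_hom is_hom_def by (intro exI[of _ "\<lambda>x. x"]) auto
  ultimately show False
    using finite_structure_caterpillar not_holds_in_T_caterpillar
    unfolding logically_equivalent_def by blast
qed

end
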